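(* Let $M$ be a bounded, connected, embedded complex submanifold of $\mathbb{C}^d$. Suppose that $M$ has the visibility property with respect to $(1,\kappa)$-almost-geodesics for some $\kappa>0$ and, moreover, that $M$ is taut. Then $\mathfrak{M}_M(r)\to0$ as $r\to0$.
   Context: $\partial M:=\overline M\setminus M$, with $\overline M$ the closure of $M$ in $\mathbb{C}^d$; $\delta_M(z)$ is the Euclidean distance from $z\in M$ to $\partial M$; $\|\cdot\|$ is the Euclidean norm; $\mathbb{D}$ is the open unit disk in $\mathbb{C}$. $\mathsf{k}_M$ is the Kobayashi distance and $\kappa_M(z;v)=\inf\{t>0:\exists\,\phi:\mathbb{D}\to M \text{ holomorphic},\ \phi(0)=z,\ t\phi'(0)=v\}$ ($z\in M$, $v\in T^{(1,0)}_zM$, the complex tangent space to $M$ at $z$) is the Kobayashi--Royden metric of $M$. For $r>0$, $$\mathfrak{M}_M(r):=\sup\left\{\frac1{\kappa_M(z;v)}: z\in M,\ \delta_M(z)\leq r,\ v\in T^{(1,0)}_zM,\ \|v\|=1\right\}.$$ $M$ is taut if every sequence of holomorphic maps $\mathbb{D}\to M$ has a subsequence that either converges uniformly on compact subsets to a holomorphic map $\mathbb{D}\to M$ or is compactly divergent. For $\kappa>0$ and an interval $I\subset\mathbb{R}$, a $(1,\kappa)$-almost-geodesic is an absolutely continuous curve $\sigma:I\to M$ such that $|t-s|-\kappa\leq\mathsf{k}_M(\sigma(t),\sigma(s))\leq|t-s|+\kappa$ for all $s,t\in I$ and $\kappa_M(\sigma(t);\sigma'(t))\leq1$ for almost every $t\in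 I$. $M$ has the visibility property with respect to $(1,\kappa)$-almost-geodesics if any two distinct points of $M$ can be joined by a $(1,\kappa)$-almost-geodesic and, for every pair of points $p\neq q$ in $\partial M$, there exist $\mathbb{C}^d$-neighbourhoods $V$ of $p$ and $W$ of $q$ with $\overline V\cap\overline W=\emptyset$ and a compact set $K\subset M$ such that every $(1,\kappa)$-almost-geodesic in $M$ with initial point in $V$ and terminal point in $W$ intersects $K$. *)

theory Defs
  imports "HOL-Analysis.Analysis"
begin

text \<open>Holomorphic maps of several variables on an open set: complex Frechet differentiability,
  i.e. the real Frechet derivative is given by a complex matrix.\<close>

definition holomorphic_map_on :: "(complex^'n \<Rightarrow> complex^'n) \<Rightarrow> (complex^'n) set \<Rightarrow> bool" where
  "holomorphic_map_on F U \<longleftrightarrow>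
     (\<forall>z\<in>U. \<exists>A :: complex^'n^'n. (F has_derivative (\<lambda>v. A *v v)) (at z))"

definition biholomorphic_on :: "(complex^'n \<Rightarrow> complex^'n) \<Rightarrow> (complex^'n) set \<Rightarrow> bool" where
  "biholomorphic_on F U \<longleftrightarrow>
     inj_on F U \<and> open (F ` U) \<and> holomorphic_map_on F U \<and> holomorphic_map_on (inv_into U F) (F ` U)"

text \<open>Near each of its points, \<open>M\<close> is flattened by an ambient holomorphic chart onto an
  open piece of the coordinate subspace spanned by the axes in \<open>S\<close>. Its dimension is
  \<open>card S\<close>; since coordinates may be permuted, the same \<open>S\<close> can serve for all points.
  \<open>M\<close> need not be closed in the ambient space.\<close>

definition complex_submanifold :: "(complex^'n) set \<Rightarrow> bool" where
  "complex_submanifold M \<longleftrightarrow>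
     (\<exists>S :: 'n set. \<forall>p\<in>M. \<exists>U F. open U \<and> p \<in> U \<and> biholomorphic_on F U \<and>
        F ` (M \<inter> U) = {w \<in> F ` U. \<forall>i. i \<notin> S \<longrightarrow> w $ i = 0})"

text \<open>As \<open>M\<close> is embedded, a map from a planar domain into \<open>M\<close> is holomorphic iff its
  components are.\<close>

definition holomorphic_into :: "complex set \<Rightarrow> (complex^'n) set \<Rightarrow> (complex \<Rightarrow> complex^'n) set" where
  "holomorphic_into D M =
     {\<phi>. (\<forall>i. (\<lambda>\<zeta>. \<phi> \<zeta> $ i) holomorphic_on D) \<and> \<phi> ` D \<subseteq> M}"

abbreviation unit_disc :: "complex set" where
  "unit_disc \<equiv> ball 0 1"

definition curve_deriv :: "(complex \<Rightarrow> complex^'n) \<Rightarrow> complex \<Rightarrow> complex^'n" where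
  "curve_deriv \<phi> \<zeta> = (\<chi> i. deriv (\<lambda>\<xi>. \<phi> \<xi> $ i) \<zeta>)"

text \<open>The holomorphic tangent space of \<open>M\<close> at \<open>z\<close>, identified as usual with a complex
  linear subspace of the ambient space: velocities of germs of holomorphic curves in \<open>M\<close>.\<close>

definition tangent_space :: "(complex^'n) set \<Rightarrow> complex^'n \<Rightarrow> (complex^'n) set" where
  "tangent_space M z =
     {v. \<exists>\<epsilon>>0. \<exists>\<gamma>\<in>holomorphic_into (ball 0 \<epsilon>) M. \<gamma> 0 = z \<and> curve_deriv \<gamma> 0 = v}"

definition mfd_boundary :: "(complex^'n) set \<Rightarrow> (complex^'n) set" where
  "mfd_boundary M = closure M - M"

text \<open>Extended-valued, so that the distance to an empty boundary is \<open>\<infinity>\<close> (whereas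
  \<^const>\<open>infdist\<close> would give \<open>0\<close>).\<close>

definition boundary_dist :: "(complex^'n) set \<Rightarrow> complex^'n \<Rightarrow> ennreal" where
  "boundary_dist M z = (INF w\<in>mfd_boundary M. ennreal (dist z w))"

definition kobayashi_metric :: "(complex^'n) set \<Rightarrow> complex^'n \<Rightarrow> complex^'n \<Rightarrow> ennreal" where
  "kobayashi_metric M z v =
     (INF t\<in>{t::real. t > 0 \<and>
        (\<exists>\<phi>\<in>holomorphic_into unit_disc M. \<phi> 0 = z \<and> t *\<^sub>R curve_deriv \<phi> 0 = v)}. ennreal t)"

text \<open>The Poincare distance is normalised to be the integrated form of
  \<open>\<bar>d\<zeta>\<bar> / (1 - \<bar>\<zeta>\<bar>\<^sup>2)\<close>, the Kobayashi metric of the disc, so that the Kobayashi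
  distance is the integrated form of the Kobayashi metric.\<close>

definition poincare_dist :: "complex \<Rightarrow> complex \<Rightarrow> real" where
  "poincare_dist a b = artanh (cmod ((a - b) / (1 - cnj b * a)))"

text \<open>Infimum of the lengths of chains of holomorphic discs from \<open>z\<close> to \<open>w\<close>:
  the \<open>j\<close>-th disc \<open>\<phi> j\<close> sends \<open>a j\<close> to \<open>p j\<close> and \<open>b j\<close> to \<open>p (j + 1)\<close>.\<close>

definition kobayashi_dist :: "(complex^'n) set \<Rightarrow> complex^'n \<Rightarrow> complex^'n \<Rightarrow> ennreal" where
  "kobayashi_dist M z w =
     Inf {ennreal (\<Sum>j<n. poincare_dist (a j) (b j)) | n a b.
       \<exists>(p :: nat \<Rightarrow> complex^'n) \<phi>. p 0 = z \<and> p n = w \<and>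
         (\<forall>j<n. \<phi> j \<in> holomorphic_into unit_disc M \<and> a j \<in> unit_disc \<and> b j \<in> unit_disc \<and>
                \<phi> j (a j) = p j \<and> \<phi> j (b j) = p (Suc j))}"

definition frakM :: "(complex^'n) set \<Rightarrow> real \<Rightarrow> ennreal" where
  "frakM M r =
     Sup {1 / kobayashi_metric M z v | z v.
       z \<in> M \<and> boundary_dist M z \<le> ennreal r \<and> v \<in> tangent_space M z \<and> norm v = 1}"

definition compactly_divergent :: "(complex^'n) set \<Rightarrow> (nat \<Rightarrow> complex \<Rightarrow> complex^'n) \<Rightarrow> bool" where
  "compactly_divergent M f \<longleftrightarrow>
     (\<forall>K L. compact K \<and> K \<subseteq> unit_disc \<and> compact L \<and> L \<subseteq> M \<longrightarrow>
        (\<forall>\<^sub>F n in sequentially. f n ` K \<inter> L = {}))"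

definition taut :: "(complex^'n) set \<Rightarrow> bool" where
  "taut M \<longleftrightarrow>
     (\<forall>f :: nat \<Rightarrow> complex \<Rightarrow> complex^'n. (\<forall>n. f n \<in> holomorphic_into unit_disc M) \<longrightarrow>
        (\<exists>r :: nat \<Rightarrow> nat. strict_mono r \<and>
           ((\<exists>g\<in>holomorphic_into unit_disc M. \<forall>K. compact K \<and> K \<subseteq> unit_disc \<longrightarrow>
               uniform_limit K (\<lambda>n. f (r n)) g sequentially)
            \<or> compactly_divergent M (\<lambda>n. f (r n)))))"

definition absolutely_continuous_curve_on :: "real set \<Rightarrow> (real \<Rightarrow> 'a::metric_space) \<Rightarrow> bool" where
  "absolutely_continuous_curve_on I \<sigma> \<longleftrightarrow>
     (\<forall>\<epsilon>>0. \<exists>\<delta>>0. \<forall>(n::nat) s t.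
        (\<forall>i<n. s i \<in> I \<and> t i \<in> I \<and> s i \<le> t i) \<and>
        disjoint_family_on (\<lambda>i. {s i<..<t i}) {..<n} \<and> (\<Sum>i<n. t i - s i) < \<delta>
        \<longrightarrow> (\<Sum>i<n. dist (\<sigma> (s i)) (\<sigma> (t i))) < \<epsilon>)"

text \<open>\<^const>\<open>ennreal\<close> truncates negative reals to \<open>0\<close>; this does not affect the lower
  bound, since distances are nonnegative.\<close>

definition almost_geodesic :: "(complex^'n) set \<Rightarrow> real \<Rightarrow> real set \<Rightarrow> (real \<Rightarrow> complex^'n) \<Rightarrow> bool" where
  "almost_geodesic M \<kappa> I \<sigma> \<longleftrightarrow>
     is_interval I \<and> \<sigma> ` I \<subseteq> M \<and> absolutely_continuous_curve_on I \<sigma> \<and>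
     (\<forall>s\<in>I. \<forall>t\<in>I. ennreal (\<bar>t - s\<bar> - \<kappa>) \<le> kobayashi_dist M (\<sigma> t) (\<sigma> s) \<and>
                  kobayashi_dist M (\<sigma> t) (\<sigma> s) \<le> ennreal (\<bar>t - s\<bar> + \<kappa>)) \<and>
     (AE t in lebesgue. t \<in> I \<longrightarrow>
        (\<exists>v. (\<sigma> has_vector_derivative v) (at t within I) \<and> kobayashi_metric M (\<sigma> t) v \<le> 1))"

definition visibility_property :: "(complex^'n) set \<Rightarrow> real \<Rightarrow> bool" where
  "visibility_property M \<kappa> \<longleftrightarrow>
     (\<forall>x\<in>M. \<forall>y\<in>M. x \<noteq> y \<longrightarrow>
        (\<exists>a b \<sigma>. a \<le> b \<and> almost_geodesic M \<kappa> {a..b} \<sigma> \<and> \<sigma> a = x \<and> \<sigma> b = y)) \<and>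
     (\<forall>p\<in>mfd_boundary M. \<forall>q\<in>mfd_boundary M. p \<noteq> q \<longrightarrow>
        (\<exists>V W K. open V \<and> p \<in> V \<and> open W \<and> q \<in> W \<and> closure V \<inter> closure W = {} \<and>
           compact K \<and> K \<subseteq> M \<and>
           (\<forall>a b \<sigma>. a \<le> b \<and> almost_geodesic M \<kappa> {a..b} \<sigma> \<and> \<sigma> a \<in> V \<and> \<sigma> b \<in> W
              \<longrightarrow> \<sigma> ` {a..b} \<inter> K \<noteq> {})))"

end

theory Submission
  imports Defs "HOL-Complex_Analysis.Cauchy_Integral_Formula"
begin

text \<open>If \<open>frakM M r\<close> does not tend to \<open>0\<close>, there are holomorphic discs \<open>\<phi>\<^sub>n\<close> in \<open>M\<close> whose
  centres approach the boundary while \<open>norm (\<phi>\<^sub>n' 0)\<close> stays bounded below. Tautness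
  makes a subsequence compactly divergent, and by Cauchy's estimate each disc moves some point of a
  fixed small circle a definite distance away from its centre. Thus the image of a radius
  has endpoints clustering at two distinct boundary points. A short radial segment has Kobayashi
  length at most \<open>\<kappa>\<close>, so its image is trivially a \<open>(1,\<kappa>)\<close>-almost-geodesic; visibility
  forces these segments to meet a fixed compact set, contradicting compact divergence.\<close>

section \<open>Local compactness of submanifolds\<close>

text \<open>In a flattening chart, \<open>M\<close> is the zero set of the coordinates outside
  \<open>S\<close>, and this condition is closed. A limit point of \<open>M\<close> inside
  \<open>U\<close> therefore satisfies it, and injectivity of the chart puts the point itself in
  \<open>M\<close>.\<close>

lemma complex_submanifold_locally_closed:
  fixes M :: "(complex^'n) set"
  assumes "complex_submanifold M" "x \<in> M"
  obtains U where "open U" "x \<in> U" "closure M \<inter> U \<subseteq> M"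
proof -
  from assms obtain S :: "'n set" and U F where U: "open U" "x \<in> U" and bi: "biholomorphic_on F U"
    and F: "F ` (M \<inter> U) = {w \<in> F ` U. \<forall>i. i \<notin> S \<longrightarrow> w $ i = 0}"
    unfolding complex_submanifold_def by blast
  have "y \<in> M" if y: "y \<in> closure M" "y \<in> U" for y
  proof -
    have cont: "isCont F y"
      using bi y(2) has_derivative_continuous
      unfolding biholomorphic_on_def holomorphic_map_on_def by blast
    \<comment> \<open>Openness of \<open>U\<close> lets the approximating sequence be chosen inside
      \<open>U\<close>, where the chart equations hold.\<close>
    have "y \<in> closure (U \<inter> M)"
      using open_Int_closure_subset[OF U(1), of M] y by blast
    then obtain s where s: "\<And>n. s n \<in> U \<inter> M" "s \<longlonglongrightarrow> y"
      unfolding closure_sequential by blast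
    have lim: "(\<lambda>n. F (s n)) \<longlonglongrightarrow> F y"
      using cont s(2) by (rule isCont_tendsto_compose)
    have "F y $ i = 0" if "i \<notin> S" for i
    proof -
      have "F (s n) \<in> F ` (M \<inter> U)" for n
        using s(1) by blast
      then have "F (s n) $ i = 0" for n
        unfolding F using that by blast
      then have "(\<lambda>n. 0) \<longlonglongrightarrow> F y $ i"
        using tendsto_vec_nth[OF lim, of i] by simp
      then show ?thesis
        using LIMSEQ_unique tendsto_const by metis
    qed
    then have "F y \<in> F ` (M \<inter> U)"
      unfolding F using y by blast
    then show "y \<in> M"
      using bi y(2) unfolding biholomorphic_on_def inj_on_def by blast
  qed
  with U that show ?thesis by blast
qed

text \<open>\<open>M\<close> is relatively open in its closure, so removing it leaves a closed set.
  This keeps limits of boundary points out of \<open>M\<close>.\<close>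

lemma closed_mfd_boundary:
  assumes "complex_submanifold M"
  shows "closed (mfd_boundary M)"
proof -
  have "\<exists>U. open U \<and> x \<in> U \<and> U \<subseteq> - mfd_boundary M" if x: "x \<in> - mfd_boundary M" for x
  proof (cases "x \<in> M")
    case True
    then obtain U where "open U" "x \<in> U" "closure M \<inter> U \<subseteq> M"
      using complex_submanifold_locally_closed[OF assms] by blast
    then show ?thesis
      unfolding mfd_boundary_def by blast
  next
    case False
    then have "x \<in> - closure M"
      using x unfolding mfd_boundary_def by blast
    moreover have "- closure M \<subseteq> - mfd_boundary M"
      unfolding mfd_boundary_def by blast
    ultimately show ?thesis
      by (meson closed_closure open_Compl)
  qed
  then have "open (- mfd_boundary M)"
    by (subst open_subopen) blast
  then show ?thesis
    by (simp add: open_closed)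
qed

text \<open>Compact divergence is tested only on compact subsets of \<open>M\<close>; this supplies
  such a set around any point of \<open>M\<close> that is a candidate for a limit.\<close>

lemma compact_neighbourhood_submanifold:
  assumes "complex_submanifold M" "x \<in> M"
  obtains e where "e > 0" "compact (cball x e \<inter> closure M)" "cball x e \<inter> closure M \<subseteq> M"
proof -
  obtain U where U: "open U" "x \<in> U" "closure M \<inter> U \<subseteq> M"
    using complex_submanifold_locally_closed[OF assms] by blast
  then obtain e where "e > 0" "cball x e \<subseteq> U"
    using open_contains_cball by blast
  with U that show ?thesis
    by (meson IntD1 IntD2 IntI closed_closure compact_Int_closed compact_cball subset_iff)
qed

text \<open>If the limit lay in \<open>M\<close>, the points \<open>f (s n) (z (s n))\<close> would
  eventually enter a compact neighbourhood of it in \<open>M\<close>, which the images of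
  \<open>K\<close> eventually avoid. The parameters \<open>z n\<close> may vary within
  \<open>K\<close>; they need not converge.\<close>

lemma compactly_divergent_limit_in_boundary:
  assumes M: "complex_submanifold M" and div: "compactly_divergent M f"
    and f: "\<And>n. f n \<in> holomorphic_into unit_disc M"
    and K: "compact K" "K \<subseteq> unit_disc" and z: "\<And>n. z n \<in> K"
    and s: "strict_mono s" and lim: "(\<lambda>n. f (s n) (z (s n))) \<longlonglongrightarrow> p"
  shows "p \<in> mfd_boundary M"
proof -
  have inM: "f n (z n) \<in> M" for n
    using f[of n] z[of n] K(2) unfolding holomorphic_into_def by blast
  have "p \<in> closure M"
    unfolding closure_sequential using inM lim by (intro exI[of _ "\<lambda>n. f (s n) (z (s n))"]) simp
  moreover have "p \<notin> M"
  proof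
    assume "p \<in> M"
    then obtain e where e: "e > 0" "compact (cball p e \<inter> closure M)" "cball p e \<inter> closure M \<subseteq> M"
      using compact_neighbourhood_submanifold[OF M] by blast
    have "\<forall>\<^sub>F n in sequentially. f n ` K \<inter> (cball p e \<inter> closure M) = {}"
      using div K e unfolding compactly_divergent_def by blast
    then have "\<forall>\<^sub>F n in sequentially. f (s n) ` K \<inter> (cball p e \<inter> closure M) = {}"
      using eventually_subseq[OF s] by blast
    moreover have "\<forall>\<^sub>F n in sequentially. dist (f (s n) (z (s n))) p < e"
      using lim e(1) by (rule tendstoD)
    ultimately have "\<forall>\<^sub>F n in sequentially. False"
    proof eventually_elim
      case (elim n)
      have "f (s n) (z (s n)) \<in> cball p e \<inter> closure M"
        using elim(2) inM[of "s n"] closure_subset[of M] by (auto simp: dist_commute)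
      with elim(1) z[of "s n"] show False by blast
    qed
    then show False by simp
  qed
  ultimately show ?thesis
    unfolding mfd_boundary_def by blast
qed

section \<open>Radial segments of holomorphic discs\<close>

lemma affine_in_unit_disc:
  assumes "cmod a \<le> 1/2" "cmod c \<le> 1/2" "\<zeta> \<in> unit_disc"
  shows "a + c * \<zeta> \<in> unit_disc"
proof -
  have "cmod (c * \<zeta>) \<le> 1/2 * cmod \<zeta>"
    unfolding norm_mult using assms(2) by (rule mult_right_mono) simp
  then show ?thesis
    using norm_triangle_ineq[of a "c * \<zeta>"] assms by simp
qed

text \<open>Recentring at \<open>a\<close> by an affine map instead of a disc automorphism costs
  sharp constants but keeps derivatives and distances explicit. The resulting discs are the
  competitors in the bounds for both the Kobayashi metric and the Kobayashi distance.\<close>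

lemma holomorphic_into_affine:
  assumes "\<phi> \<in> holomorphic_into unit_disc M" "cmod a \<le> 1/2" "cmod c \<le> 1/2"
  shows "(\<lambda>\<zeta>. \<phi> (a + c * \<zeta>)) \<in> holomorphic_into unit_disc M"
proof -
  have sub: "(\<lambda>\<zeta>. a + c * \<zeta>) ` unit_disc \<subseteq> unit_disc"
    using affine_in_unit_disc[OF assms(2,3)] by blast
  have "(\<lambda>\<zeta>. \<phi> (a + c * \<zeta>) $ i) holomorphic_on unit_disc" for i
  proof -
    have "(\<lambda>\<xi>. \<phi> \<xi> $ i) holomorphic_on unit_disc"
      using assms(1) unfolding holomorphic_into_def by blast
    from holomorphic_on_compose_gen[OF _ this sub] show ?thesis
      by (simp add: o_def holomorphic_intros)
  qed
  then show ?thesis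
    using assms(1) sub unfolding holomorphic_into_def by blast
qed

lemma holomorphic_into_has_field_derivative:
  assumes "\<phi> \<in> holomorphic_into unit_disc M" "a \<in> unit_disc"
  shows "((\<lambda>\<xi>. \<phi> \<xi> $ i) has_field_derivative curve_deriv \<phi> a $ i) (at a)"
  using assms unfolding holomorphic_into_def curve_deriv_def
  by (auto intro: holomorphic_derivI[OF _ open_ball])

lemma curve_deriv_affine:
  assumes "\<phi> \<in> holomorphic_into unit_disc M" "a \<in> unit_disc"
  shows "curve_deriv (\<lambda>\<zeta>. \<phi> (a + c * \<zeta>)) 0 = c *s curve_deriv \<phi> a"
proof -
  have "((\<lambda>\<zeta>. \<phi> (a + c * \<zeta>) $ i) has_field_derivative curve_deriv \<phi> a $ i * c) (at 0)" for i
  proof -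
    have "((\<lambda>\<zeta>. a + c * \<zeta>) has_field_derivative c) (at 0)"
      by (auto intro!: derivative_eq_intros)
    then show ?thesis
      using holomorphic_into_has_field_derivative[OF assms, of i]
      by (intro DERIV_chain2[where f = "\<lambda>\<xi>. \<phi> \<xi> $ i"]) simp_all
  qed
  from DERIV_imp_deriv[OF this] show ?thesis
    by (simp add: vec_eq_iff curve_deriv_def mult.commute)
qed

text \<open>The disc recentred at \<open>a\<close> and scaled by \<open>c\<close> has exactly the
  given velocity at its centre, so \<open>t = 1\<close> is admissible in the infimum.\<close>

lemma kobayashi_metric_le_one:
  assumes "\<phi> \<in> holomorphic_into unit_disc M" "cmod a \<le> 1/2" "cmod c \<le> 1/2"
  shows "kobayashi_metric M (\<phi> a) (c *s curve_deriv \<phi> a) \<le> 1"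
proof -
  have "a \<in> unit_disc"
    using assms(2) by simp
  then have "1 \<in> {t::real. t > 0 \<and> (\<exists>\<psi>\<in>holomorphic_into unit_disc M.
      \<psi> 0 = \<phi> a \<and> t *\<^sub>R curve_deriv \<psi> 0 = c *s curve_deriv \<phi> a)}"
    using holomorphic_into_affine[OF assms] curve_deriv_affine[OF assms(1), of a c]
    by (auto intro!: bexI[of _ "\<lambda>\<zeta>. \<phi> (a + c * \<zeta>)"])
  from INF_lower[OF this, of ennreal] show ?thesis
    unfolding kobayashi_metric_def by simp
qed

text \<open>By ln u \<le> u - 1, twice \<open>artanh x\<close> is at most 2x / (1 - x), and the
  denominator is at least 1/2.\<close>

lemma artanh_le_double:
  fixes x :: real
  assumes "0 \<le> x" "x \<le> 1/2"
  shows "artanh x \<le> 2 * x"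
proof -
  have "ln ((1 + x) / (1 - x)) \<le> (1 + x) / (1 - x) - 1"
    using assms by (intro ln_le_minus_one) simp
  also have "\<dots> = 2 * x / (1 - x)"
    using assms by (simp add: field_simps)
  also have "\<dots> \<le> 2 * x / (1/2)"
    using assms by (intro divide_left_mono) auto
  finally show ?thesis
    unfolding artanh_def by simp
qed

text \<open>A single disc centred at \<open>\<phi> a\<close> with half the parameter scale reaches
  \<open>\<phi> b\<close> at \<open>w\<close>, whose modulus is twice that of \<open>b - a\<close>.
  The bound on \<open>artanh\<close> doubles again, which gives the factor 4.\<close>

lemma kobayashi_dist_le:
  assumes "\<phi> \<in> holomorphic_into unit_disc M" "cmod a \<le> 1/2" "cmod (b - a) \<le> 1/4"
  shows "kobayashi_dist M (\<phi> a) (\<phi> b) \<le> ennreal (4 * cmod (b - a))"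
proof -
  define \<psi> where "\<psi> = (\<lambda>\<zeta>. \<phi> (a + 1/2 * \<zeta>))"
  define w where "w = 2 * (b - a)"
  have \<psi>: "\<psi> \<in> holomorphic_into unit_disc M"
    unfolding \<psi>_def by (rule holomorphic_into_affine[OF assms(1,2)]) simp
  have w: "cmod w = 2 * cmod (b - a)"
    unfolding w_def norm_mult by simp
  have \<psi>0: "\<psi> 0 = \<phi> a" and \<psi>w: "\<psi> w = \<phi> b"
    by (simp_all add: \<psi>_def w_def diff_divide_distrib)
  have "kobayashi_dist M (\<phi> a) (\<phi> b) \<le> ennreal (\<Sum>j<1::nat. poincare_dist 0 w)"
    unfolding kobayashi_dist_def
  \<comment> \<open>The chain has one link: parameters 0 and \<open>w\<close>, disc
    \<open>\<psi>\<close>, and vertices \<open>\<phi> a\<close> at index 0 and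
    \<open>\<phi> b\<close> at every successor.\<close>
  proof (rule Inf_lower, rule CollectI, intro exI conjI)
    show "ennreal (\<Sum>j<1::nat. poincare_dist 0 w)
      = ennreal (\<Sum>j<1::nat. poincare_dist ((\<lambda>_. 0) j) ((\<lambda>_. w) j))" by (rule refl)
    show "(case (0::nat) of 0 \<Rightarrow> \<phi> a | Suc _ \<Rightarrow> \<phi> b) = \<phi> a" by simp
    show "(case (1::nat) of 0 \<Rightarrow> \<phi> a | Suc _ \<Rightarrow> \<phi> b) = \<phi> b" by simp
    show "\<forall>j<1::nat. (\<lambda>_. \<psi>) j \<in> holomorphic_into unit_disc M \<and> 0 \<in> unit_disc \<and> w \<in> unit_disc \<and>
        (\<lambda>_. \<psi>) j 0 = (case j of 0 \<Rightarrow> \<phi> a | Suc _ \<Rightarrow> \<phi> b) \<and>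
        (\<lambda>_. \<psi>) j w = (case Suc j of 0 \<Rightarrow> \<phi> a | Suc _ \<Rightarrow> \<phi> b)"
      using \<psi> w assms(3) \<psi>0 \<psi>w by simp
  qed
  also have "\<dots> \<le> ennreal (4 * cmod (b - a))"
    using artanh_le_double[of "cmod w"] w assms(3)
    by (intro ennreal_leI) (simp add: poincare_dist_def)
  finally show ?thesis .
qed

lemma lipschitz_imp_absolutely_continuous_curve:
  assumes "B-lipschitz_on I \<sigma>"
  shows "absolutely_continuous_curve_on I \<sigma>"
  unfolding absolutely_continuous_curve_on_def
proof (intro allI impI)
  fix \<epsilon> :: real assume "\<epsilon> > 0"
  have B: "B \<ge> 0"
    using assms lipschitz_on_nonneg by blast
  show "\<exists>\<delta>>0. \<forall>(n::nat) s t.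
        (\<forall>i<n. s i \<in> I \<and> t i \<in> I \<and> s i \<le> t i) \<and>
        disjoint_family_on (\<lambda>i. {s i<..<t i}) {..<n} \<and> (\<Sum>i<n. t i - s i) < \<delta>
        \<longrightarrow> (\<Sum>i<n. dist (\<sigma> (s i)) (\<sigma> (t i))) < \<epsilon>"
  \<comment> \<open>Dividing by \<open>B + 1\<close> rather than \<open>B\<close> covers the case
    \<open>B = 0\<close> and makes the final inequality strict.\<close>
  proof (intro exI[of _ "\<epsilon> / (B + 1)"] conjI allI impI; (elim conjE)?)
    show "\<epsilon> / (B + 1) > 0" using \<open>\<epsilon> > 0\<close> B by simp
    fix n :: nat and s t
    assume st: "\<forall>i<n. s i \<in> I \<and> t i \<in> I \<and> s i \<le> t i" and sum: "(\<Sum>i<n. t i - s i) < \<epsilon> / (B + 1)"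
    have "(\<Sum>i<n. dist (\<sigma> (s i)) (\<sigma> (t i))) \<le> (\<Sum>i<n. B * (t i - s i))"
    proof (rule sum_mono)
      fix i assume "i \<in> {..<n}"
      with st have i: "s i \<in> I" "t i \<in> I" "s i \<le> t i" by auto
      show "dist (\<sigma> (s i)) (\<sigma> (t i)) \<le> B * (t i - s i)"
        using lipschitz_onD[OF assms i(1,2)] i(3) by (simp add: dist_real_def)
    qed
    also have "\<dots> = B * (\<Sum>i<n. t i - s i)"
      by (simp add: sum_distrib_left)
    also have "\<dots> \<le> B * (\<epsilon> / (B + 1))"
      using B sum by (intro mult_left_mono) auto
    also have "\<dots> < \<epsilon>"
      using B \<open>\<epsilon> > 0\<close> by (simp add: field_simps)
    finally show "(\<Sum>i<n. dist (\<sigma> (s i)) (\<sigma> (t i))) < \<epsilon>" .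
  qed
qed

lemma holomorphic_segment_has_vector_derivative:
  fixes \<phi> :: "complex \<Rightarrow> complex^'n"
  assumes "\<phi> \<in> holomorphic_into unit_disc M" "complex_of_real t * c \<in> unit_disc"
  shows "((\<lambda>t. \<phi> (of_real t * c)) has_vector_derivative c *s curve_deriv \<phi> (of_real t * c))
           (at t within I)"
proof -
  have "((\<lambda>t. \<phi> (of_real t * c) $ i) has_vector_derivative c * curve_deriv \<phi> (of_real t * c) $ i)
           (at t within I)" for i
  proof -
    have "((\<lambda>t. complex_of_real t * c) has_vector_derivative c) (at t within I)"
      by (auto intro!: derivative_eq_intros)
    from field_vector_diff_chain_within[OF this
        DERIV_subset[OF holomorphic_into_has_field_derivative[OF assms, of i] subset_UNIV]]
    show ?thesis by (simp add: o_def)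
  qed
  \<comment> \<open>The basis vectors of the ambient space are axes carrying a real basis vector
    \<open>u\<close> of the complex plane, so componentwise differentiability is tested against all
    such pairs of \<open>i\<close> and \<open>u\<close>.\<close>
  then have "((\<lambda>t. \<phi> (of_real t * c) $ i \<bullet> u) has_derivative
      (\<lambda>x. (x *\<^sub>R (c * curve_deriv \<phi> (of_real t * c) $ i)) \<bullet> u)) (at t within I)" for i u
    unfolding has_vector_derivative_def by (rule has_derivative_inner_left)
  then show ?thesis
    unfolding has_vector_derivative_def
    by (subst has_derivative_componentwise_within) (auto simp: Basis_vec_def inner_axis)
qed

lemma continuous_on_curve_deriv:
  fixes \<phi> :: "complex \<Rightarrow> complex^'n"
  assumes "\<phi> \<in> holomorphic_into unit_disc M"
  shows "continuous_on unit_disc (curve_deriv \<phi>)"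
proof -
  have "continuous_on unit_disc (\<lambda>\<zeta>. deriv (\<lambda>\<xi>. \<phi> \<xi> $ i) \<zeta>)" for i
    using assms unfolding holomorphic_into_def
    by (intro holomorphic_on_imp_continuous_on holomorphic_deriv) auto
  then show ?thesis
    unfolding curve_deriv_def by (intro continuous_on_vec_lambda)
qed

text \<open>The additive error \<open>\<kappa>\<close> absorbs all metric information about so short
  a curve: the lower distance bound is vacuous and a crude Lipschitz estimate gives the upper one.
  The bound on \<open>c\<close> keeps the Kobayashi speed at most 1.\<close>

lemma almost_geodesic_short_segment:
  fixes \<phi> :: "complex \<Rightarrow> complex^'n"
  assumes \<phi>: "\<phi> \<in> holomorphic_into unit_disc M" and c: "cmod c \<le> 1/2"
    and L: "0 \<le> L" "L \<le> 1/2" "2 * L \<le> \<kappa>"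
  shows "almost_geodesic M \<kappa> {0..L} (\<lambda>t. \<phi> (of_real t * c))"
  unfolding almost_geodesic_def
proof (intro conjI)
  have ofr: "cmod (of_real t * c) \<le> \<bar>t\<bar> / 2" for t
    using mult_left_mono[OF c, of "\<bar>t\<bar>"] by (simp add: norm_mult)
  have norm: "cmod (of_real t * c) \<le> 1/4" if "t \<in> {0..L}" for t
    using ofr[of t] that L by simp
  then have disc: "of_real t * c \<in> unit_disc" if "t \<in> {0..L}" for t
    using that by fastforce
  show "is_interval {0..L}"
    by (rule is_interval_cc)
  show "(\<lambda>t. \<phi> (of_real t * c)) ` {0..L} \<subseteq> M"
    using \<phi> disc unfolding holomorphic_into_def by blast
  have der: "((\<lambda>t. \<phi> (of_real t * c)) has_vector_derivative c *s curve_deriv \<phi> (of_real t * c))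
           (at t within {0..L})" if "t \<in> {0..L}" for t
    using holomorphic_segment_has_vector_derivative[OF \<phi> disc[OF that]] .
  show "AE t in lebesgue. t \<in> {0..L} \<longrightarrow>
      (\<exists>v. ((\<lambda>t. \<phi> (of_real t * c)) has_vector_derivative v) (at t within {0..L}) \<and>
        kobayashi_metric M (\<phi> (of_real t * c)) v \<le> 1)"
  proof (intro AE_I2 impI exI conjI)
    fix t assume t: "t \<in> {0..L}"
    show "((\<lambda>t. \<phi> (of_real t * c)) has_vector_derivative c *s curve_deriv \<phi> (of_real t * c))
           (at t within {0..L})" by (rule der[OF t])
    show "kobayashi_metric M (\<phi> (of_real t * c)) (c *s curve_deriv \<phi> (of_real t * c)) \<le> 1"
      using norm[OF t] by (intro kobayashi_metric_le_one[OF \<phi> _ c]) simp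
  qed
  show "\<forall>s\<in>{0..L}. \<forall>t\<in>{0..L}.
      ennreal (\<bar>t - s\<bar> - \<kappa>) \<le> kobayashi_dist M (\<phi> (of_real t * c)) (\<phi> (of_real s * c)) \<and>
      kobayashi_dist M (\<phi> (of_real t * c)) (\<phi> (of_real s * c)) \<le> ennreal (\<bar>t - s\<bar> + \<kappa>)"
  proof (intro ballI conjI)
    fix s t assume st: "s \<in> {0..L}" "t \<in> {0..L}"
    then have abs: "\<bar>t - s\<bar> \<le> L" by auto
    \<comment> \<open>The difference is nonpositive, since its first term is at most
      \<open>L\<close> and \<open>L\<close> is at most \<open>\<kappa>\<close>;
      \<open>ennreal\<close> sends it to 0.\<close>
    then show "ennreal (\<bar>t - s\<bar> - \<kappa>) \<le> kobayashi_dist M (\<phi> (of_real t * c)) (\<phi> (of_real s * c))"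
      using L by (simp add: ennreal_neg)
    have le: "cmod (of_real s * c - of_real t * c) \<le> \<bar>t - s\<bar> / 2"
      using ofr[of "s - t"] by (simp add: left_diff_distrib abs_minus_commute)
    have "kobayashi_dist M (\<phi> (of_real t * c)) (\<phi> (of_real s * c))
        \<le> ennreal (4 * cmod (of_real s * c - of_real t * c))"
      using le abs L norm[OF st(2)] by (intro kobayashi_dist_le[OF \<phi>]) auto
    also have "\<dots> \<le> ennreal (2 * \<bar>t - s\<bar>)"
      using le by (intro ennreal_leI) simp
    \<comment> \<open>One of the two copies of the parameter distance is at most \<open>L\<close>,
      hence at most \<open>\<kappa>\<close>.\<close>
    also have "\<dots> \<le> ennreal (\<bar>t - s\<bar> + \<kappa>)"
      using abs L by (intro ennreal_leI) simp
    finally show "kobayashi_dist M (\<phi> (of_real t * c)) (\<phi> (of_real s * c)) \<le> ennreal (\<bar>t - s\<bar> + \<kappa>)" .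
  qed
  \<comment> \<open>Absolute continuity comes from a Lipschitz bound: the velocity is continuous,
    hence bounded, on the compact parameter interval.\<close>
  have "continuous_on {0..L} (\<lambda>t. curve_deriv \<phi> (of_real t * c))"
    by (rule continuous_on_compose2[OF continuous_on_curve_deriv[OF \<phi>]])
      (use disc in \<open>auto intro!: continuous_intros\<close>)
  then have "continuous_on {0..L} (\<lambda>t. c *s curve_deriv \<phi> (of_real t * c))"
    unfolding vector_scalar_mult_def by (intro continuous_intros)
  then have "bounded ((\<lambda>t. c *s curve_deriv \<phi> (of_real t * c)) ` {0..L})"
    using compact_continuous_image compact_imp_bounded by blast
  then obtain B where B: "B > 0" "\<And>t. t \<in> {0..L} \<Longrightarrow> norm (c *s curve_deriv \<phi> (of_real t * c)) \<le> B"
    unfolding bounded_pos by auto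
  have "B-lipschitz_on {0..L} (\<lambda>t. \<phi> (of_real t * c))"
  proof (rule bounded_derivative_imp_lipschitz)
    fix t assume t: "t \<in> {0..L}"
    show "((\<lambda>t. \<phi> (of_real t * c)) has_derivative (\<lambda>x. x *\<^sub>R (c *s curve_deriv \<phi> (of_real t * c))))
        (at t within {0..L})"
      using der[OF t] unfolding has_vector_derivative_def .
    show "onorm (\<lambda>x. x *\<^sub>R (c *s curve_deriv \<phi> (of_real t * c))) \<le> B"
    proof (rule onorm_le)
      fix x :: real
      show "norm (x *\<^sub>R (c *s curve_deriv \<phi> (of_real t * c))) \<le> B * norm x"
        unfolding norm_scaleR using mult_left_mono[OF B(2)[OF t], of "\<bar>x\<bar>"] by (simp add: mult.commute)
    qed
  qed (use B in auto)
  then show "absolutely_continuous_curve_on {0..L} (\<lambda>t. \<phi> (of_real t * c))"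
    by (rule lipschitz_imp_absolutely_continuous_curve)
qed

text \<open>Cauchy's inequality is applied to each coordinate of the disc minus its centre value,
  which leaves the derivative unchanged; summing the coordinates gives \<open>CARD('n)\<close>. Read
  contrapositively, a large derivative forces some point of the circle to move far from the
  centre.\<close>

lemma norm_curve_deriv_le:
  fixes \<phi> :: "complex \<Rightarrow> complex^'n"
  assumes \<phi>: "\<phi> \<in> holomorphic_into unit_disc M" and \<rho>: "0 < \<rho>" "\<rho> < 1"
    and le: "\<And>\<zeta>. cmod \<zeta> = \<rho> \<Longrightarrow> norm (\<phi> \<zeta> - \<phi> 0) \<le> \<delta>"
  shows "norm (curve_deriv \<phi> 0) \<le> real CARD('n) * (\<delta> / \<rho>)"
proof -
  have "cmod (curve_deriv \<phi> 0 $ i) \<le> \<delta> / \<rho>" for i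
  proof -
    let ?f = "\<lambda>\<zeta>. \<phi> \<zeta> $ i - \<phi> 0 $ i"
    have hol: "?f holomorphic_on unit_disc"
      using \<phi> unfolding holomorphic_into_def by (auto intro!: holomorphic_intros)
    have sub: "cball 0 \<rho> \<subseteq> unit_disc" "ball 0 \<rho> \<subseteq> unit_disc"
      using \<rho> by auto
    have "cmod ((deriv ^^ 1) ?f 0) \<le> fact 1 * \<delta> / \<rho> ^ 1"
    proof (rule Cauchy_inequality)
      show "?f holomorphic_on ball 0 \<rho>"
        using hol sub(2) by (rule holomorphic_on_subset)
      show "continuous_on (cball 0 \<rho>) ?f"
        using holomorphic_on_imp_continuous_on[OF hol] sub(1) by (rule continuous_on_subset)
      fix \<zeta> assume "cmod (0 - \<zeta>) = \<rho>"
      then have "norm (\<phi> \<zeta> - \<phi> 0) \<le> \<delta>"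
        using le by simp
      then show "cmod (?f \<zeta>) \<le> \<delta>"
        using Finite_Cartesian_Product.norm_nth_le[of "\<phi> \<zeta> - \<phi> 0" i] by simp
    qed (use \<rho> in auto)
    moreover have "deriv ?f 0 = curve_deriv \<phi> 0 $ i"
      using holomorphic_into_has_field_derivative[OF \<phi>, of 0 i]
      by (intro DERIV_imp_deriv) (auto intro!: derivative_eq_intros)
    ultimately show ?thesis by simp
  qed
  then have "(\<Sum>i\<in>UNIV. cmod (curve_deriv \<phi> 0 $ i)) \<le> real CARD('n) * (\<delta> / \<rho>)"
    using sum_bounded_above[of UNIV "\<lambda>i. cmod (curve_deriv \<phi> 0 $ i)" "\<delta> / \<rho>"] by simp
  moreover have "norm (curve_deriv \<phi> 0) \<le> (\<Sum>i\<in>UNIV. cmod (curve_deriv \<phi> 0 $ i))"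
    unfolding norm_vec_def by (rule L2_set_le_sum) simp
  ultimately show ?thesis by linarith
qed

section \<open>Discs near the boundary\<close>

lemma frakM_mono:
  assumes "r \<le> r'"
  shows "frakM M r \<le> frakM M r'"
proof -
  have "ennreal r \<le> ennreal r'"
    using assms by (rule ennreal_leI)
  then show ?thesis
    unfolding frakM_def by (intro Sup_subset_mono) (use order_trans in blast)
qed

text \<open>Unwinding the supremum and then the infimum gives a disc with \<open>t < 1 / c\<close>;
  since \<open>v\<close> is a unit vector, its derivative has norm 1 / t, which exceeds
  \<open>c\<close>.\<close>

lemma frakM_gt_imp_disc:
  assumes "ennreal c < frakM M r" "c > 0" "r > 0"
  obtains \<phi> w where "\<phi> \<in> holomorphic_into unit_disc M" "norm (curve_deriv \<phi> 0) > c"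
    "w \<in> mfd_boundary M" "dist (\<phi> 0) w < 2 * r"
proof -
  obtain z v where zv: "z \<in> M" "boundary_dist M z \<le> ennreal r" "norm v = 1"
    "ennreal c < 1 / kobayashi_metric M z v"
    using assms(1) unfolding frakM_def less_Sup_iff by blast
  have "kobayashi_metric M z v < ennreal (1 / c)"
  proof (rule ccontr)
    assume "\<not> ?thesis"
    then have ge: "ennreal (1 / c) \<le> kobayashi_metric M z v" by simp
    show False
    proof (cases "kobayashi_metric M z v")
      case (real k)
      then have "1 / c \<le> k"
        using ge by simp
      moreover have "0 < 1 / c"
        using assms(2) by simp
      ultimately have "0 < k" by linarith
      with \<open>1 / c \<le> k\<close> have "1 / k \<le> c"
        using assms(2) by (simp add: field_simps)
      then have "1 / kobayashi_metric M z v \<le> ennreal c"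
        unfolding real using divide_ennreal[of 1 k] \<open>0 < k\<close> by (simp add: ennreal_leI)
      with zv(4) show False by simp
    next
      \<comment> \<open>Here the reciprocal is 0, which cannot exceed
        \<open>ennreal c\<close>.\<close>
      case top
      with zv(4) show False by simp
    qed
  qed
  then obtain t \<phi> where t: "t > 0" "ennreal t < ennreal (1 / c)"
    and \<phi>: "\<phi> \<in> holomorphic_into unit_disc M" "\<phi> 0 = z" "t *\<^sub>R curve_deriv \<phi> 0 = v"
    unfolding kobayashi_metric_def INF_less_iff by blast
  have "t < 1 / c"
    using t by (simp add: ennreal_less_iff)
  moreover have "t * norm (curve_deriv \<phi> 0) = 1"
    using \<phi>(3) zv(3) t(1) by (metis abs_of_pos norm_scaleR)
  ultimately have "t * c < t * norm (curve_deriv \<phi> 0)"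
    using assms(2) by (simp add: field_simps)
  then have "norm (curve_deriv \<phi> 0) > c"
    using t(1) by simp
  \<comment> \<open>A strict bound is needed to extract an actual boundary point from the infimum;
    doubling \<open>r\<close> provides the slack.\<close>
  moreover have "boundary_dist M z < ennreal (2 * r)"
    using zv(2) by (rule le_less_trans) (use assms(3) in \<open>simp add: ennreal_less_iff\<close>)
  then obtain w where "w \<in> mfd_boundary M" "dist z w < 2 * r"
    unfolding boundary_dist_def INF_less_iff by (auto simp: ennreal_less_iff)
  ultimately show ?thesis
    using \<phi> that by blast
qed

text \<open>In the convergent alternative, the centres and the nearby boundary points
  \<open>w\<close> would share the limit \<open>g 0\<close>. It lies in \<open>M\<close>, yet
  closedness of the boundary places it there too.\<close>

lemma taut_boundary_discs_compactly_divergent: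
  fixes \<phi> :: "nat \<Rightarrow> complex \<Rightarrow> complex^'n"
  assumes M: "complex_submanifold M" "taut M"
    and \<phi>: "\<And>n. \<phi> n \<in> holomorphic_into unit_disc M"
    and w: "\<And>n. w n \<in> mfd_boundary M" "(\<lambda>n. dist (\<phi> n 0) (w n)) \<longlonglongrightarrow> 0"
  obtains r where "strict_mono r" "compactly_divergent M (\<lambda>n. \<phi> (r n))"
proof -
  obtain r where r: "strict_mono r" and alt: "(\<exists>g\<in>holomorphic_into unit_disc M.
      \<forall>K. compact K \<and> K \<subseteq> unit_disc \<longrightarrow> uniform_limit K (\<lambda>n. \<phi> (r n)) g sequentially)
      \<or> compactly_divergent M (\<lambda>n. \<phi> (r n))"
    using M(2) \<phi> unfolding taut_def by blast
  have False if g: "g \<in> holomorphic_into unit_disc M" and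
    "\<forall>K. compact K \<and> K \<subseteq> unit_disc \<longrightarrow> uniform_limit K (\<lambda>n. \<phi> (r n)) g sequentially" for g
  proof -
    have "(\<lambda>n. \<phi> (r n) 0) \<longlonglongrightarrow> g 0"
      using that(2)[rule_format, of "{0}"] by simp
    moreover have "(\<lambda>n. \<phi> (r n) 0 - w (r n)) \<longlonglongrightarrow> 0"
      using LIMSEQ_subseq_LIMSEQ[OF w(2) r]
      by (subst tendsto_norm_zero_iff[symmetric]) (simp add: o_def dist_norm)
    ultimately have "(\<lambda>n. w (r n)) \<longlonglongrightarrow> g 0"
      by (rule Lim_transform2)
    then have "g 0 \<in> mfd_boundary M"
      using closed_sequentially[OF closed_mfd_boundary[OF M(1)], of "\<lambda>n. w (r n)"] w(1) by blast
    moreover have "g 0 \<in> M"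
      using g unfolding holomorphic_into_def by auto
    ultimately show False
      unfolding mfd_boundary_def by blast
  qed
  with alt r that show ?thesis by blast
qed

text \<open>Boundedness of \<open>M\<close> supplies limits of the endpoints, compact divergence
  puts them in the boundary, and the derivative bound keeps them apart, so that visibility
  applies.\<close>

lemma visibility_imp_compactly_divergent_discs_flat:
  fixes f :: "nat \<Rightarrow> complex \<Rightarrow> complex^'n"
  assumes M: "bounded M" "complex_submanifold M" and \<kappa>: "\<kappa> > 0" "visibility_property M \<kappa>"
    and f: "\<And>n. f n \<in> holomorphic_into unit_disc M" and div: "compactly_divergent M f"
    and c: "c > 0" "\<And>n. norm (curve_deriv (f n) 0) > c"
  shows False
proof -
  \<comment> \<open>Both caps are the length restrictions under which a radial segment is an
    almost-geodesic.\<close>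
  define L where "L = min (1/2) (\<kappa> / 2)"
  have L: "0 < L" "L \<le> 1/2" "2 * L \<le> \<kappa>"
    using \<kappa>(1) unfolding L_def by auto
  \<comment> \<open>This value makes the Cauchy bound on the circle of radius \<open>L / 2\<close>
    equal to \<open>c\<close>.\<close>
  define \<delta> where "\<delta> = c * (L / 2) / real CARD('n)"
  have \<delta>: "\<delta> > 0"
    unfolding \<delta>_def using c(1) L(1) by simp
  have "\<exists>\<zeta>. cmod \<zeta> = L / 2 \<and> norm (f n \<zeta> - f n 0) > \<delta>" for n
  proof (rule ccontr)
    assume "\<not> ?thesis"
    then have "norm (f n \<zeta> - f n 0) \<le> \<delta>" if "cmod \<zeta> = L / 2" for \<zeta>
      using that by (meson not_le)
    then have "norm (curve_deriv (f n) 0) \<le> real CARD('n) * (\<delta> / (L / 2))"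
      using L by (intro norm_curve_deriv_le[OF f]) auto
    also have "\<dots> = c"
      unfolding \<delta>_def using L(1) by simp
    finally show False using c(2)[of n] by simp
  qed
  then obtain \<zeta> where \<zeta>: "\<And>n. cmod (\<zeta> n) = L / 2" "\<And>n. norm (f n (\<zeta> n) - f n 0) > \<delta>"
    by metis
  let ?D = "cball (0::complex) (1/2)"
  have D: "compact ?D" "?D \<subseteq> unit_disc" by auto
  have \<zeta>D: "\<zeta> n \<in> ?D" for n
    using \<zeta>(1)[of n] L by simp
  have inM: "f n \<xi> \<in> M" if "\<xi> \<in> ?D" for n \<xi>
    using f[of n] that D(2) unfolding holomorphic_into_def by blast
  \<comment> \<open>Working in the product yields one subsequence along which both endpoints
    converge.\<close>
  have "compact (closure M \<times> closure M)"
    using M(1) by (intro compact_Times) (auto simp: compact_closure)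
  moreover have "(f n 0, f n (\<zeta> n)) \<in> closure M \<times> closure M" for n
    using inM[of 0 n] inM[OF \<zeta>D[of n], of n] closure_subset[of M] by auto
  ultimately obtain l s where s: "strict_mono s"
    and lim: "((\<lambda>n. (f n 0, f n (\<zeta> n))) \<circ> s) \<longlonglongrightarrow> l"
    using seq_compactE[OF compact_imp_seq_compact, of "closure M \<times> closure M"
        "\<lambda>n. (f n 0, f n (\<zeta> n))"] by blast
  define p q where "p = fst l" and "q = snd l"
  have p: "(\<lambda>n. f (s n) 0) \<longlonglongrightarrow> p" and q: "(\<lambda>n. f (s n) (\<zeta> (s n))) \<longlonglongrightarrow> q"
    using tendsto_fst[OF lim] tendsto_snd[OF lim] by (simp_all add: o_def p_def q_def)
  have pq: "p \<in> mfd_boundary M" "q \<in> mfd_boundary M"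
    using compactly_divergent_limit_in_boundary[OF M(2) div f D, of "\<lambda>_. 0", OF _ s p]
      compactly_divergent_limit_in_boundary[OF M(2) div f D \<zeta>D s q] by auto
  \<comment> \<open>The separation of the endpoints survives in the limit as a weak inequality,
    which is enough for distinctness.\<close>
  have "\<delta> \<le> norm (q - p)"
    using \<zeta>(2) by (intro tendsto_lowerbound[OF tendsto_norm[OF tendsto_diff[OF q p]]] always_eventually)
      (auto intro: less_imp_le)
  with \<delta> have "p \<noteq> q" by auto
  from \<kappa>(2)[unfolded visibility_property_def, THEN conjunct2, rule_format, OF pq this]
  obtain V W K where VW: "open V" "p \<in> V" "open W" "q \<in> W" and K: "compact K" "K \<subseteq> M"
    and meet: "\<forall>a b \<sigma>. a \<le> b \<and> almost_geodesic M \<kappa> {a..b} \<sigma> \<and> \<sigma> a \<in> V \<and> \<sigma> b \<in> W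
              \<longrightarrow> \<sigma> ` {a..b} \<inter> K \<noteq> {}"
    by (elim exE conjE) (rule that; assumption)
  have "\<forall>\<^sub>F n in sequentially. f n ` ?D \<inter> K = {}"
    using div K D unfolding compactly_divergent_def by blast
  then have "\<forall>\<^sub>F n in sequentially. f (s n) ` ?D \<inter> K = {}"
    using eventually_subseq[OF s] by blast
  moreover have "\<forall>\<^sub>F n in sequentially. f (s n) 0 \<in> V"
    using topological_tendstoD[OF p VW(1,2)] .
  moreover have "\<forall>\<^sub>F n in sequentially. f (s n) (\<zeta> (s n)) \<in> W"
    using topological_tendstoD[OF q VW(3,4)] .
  ultimately have "\<forall>\<^sub>F n in sequentially. False"
  proof eventually_elim
    case (elim n)
    \<comment> \<open>With this direction, of modulus 1/2, the radial segment reaches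
      \<open>\<zeta> (s n)\<close> exactly at time \<open>L\<close>.\<close>
    define e where "e = \<zeta> (s n) / of_real L"
    have e: "cmod e = 1/2" "of_real L * e = \<zeta> (s n)"
      using \<zeta>(1)[of "s n"] L(1) by (simp_all add: e_def norm_divide)
    have "almost_geodesic M \<kappa> {0..L} (\<lambda>t. f (s n) (of_real t * e))"
      using L e(1) by (intro almost_geodesic_short_segment[OF f]) auto
    then have "(\<lambda>t. f (s n) (of_real t * e)) ` {0..L} \<inter> K \<noteq> {}"
      using L(1) elim(2,3) e(2) by (intro meet[rule_format]) auto
    moreover have "of_real t * e \<in> ?D" if "t \<in> {0..L}" for t
      using that L(2) unfolding mem_cball_0 norm_mult e(1) by simp
    ultimately show False
      using elim(1) by blast
  qed
  then show False by simp
qed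

theorem theorem6p4:
  fixes M :: "(complex^'n) set" and \<kappa> :: real
  assumes "bounded M" and "connected M" and "complex_submanifold M"
    and "\<kappa> > 0" and "visibility_property M \<kappa>"
    and "taut M"
  shows "(frakM M \<longlongrightarrow> 0) (at_right 0)"
proof (rule order_tendstoI)
  fix a :: ennreal assume "0 < a"
  \<comment> \<open>Density gives a finite positive value below \<open>a\<close>, which may itself
    be infinite; it becomes the real lower bound for derivatives.\<close>
  then obtain c where c: "c > 0" "ennreal c < a"
    using ennreal_rat_dense[of 0 a] by (metis ennreal_less_zero_iff)
  \<comment> \<open>By monotonicity of \<open>frakM M\<close>, one such radius controls all smaller
    ones. If there were none, the radii 1 / (n + 1) would produce the sequence of discs to be
    excluded.\<close>
  have "\<exists>r>0. frakM M r \<le> ennreal c"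
  proof (rule ccontr)
    assume "\<not> ?thesis"
    then have gt: "ennreal c < frakM M r" if "r > 0" for r
      using that by (meson not_le)
    have "\<exists>\<phi> w. \<phi> \<in> holomorphic_into unit_disc M \<and> norm (curve_deriv \<phi> 0) > c \<and>
        w \<in> mfd_boundary M \<and> dist (\<phi> 0) w < 2 * inverse (real (Suc n))" for n
    proof -
      have pos: "inverse (real (Suc n)) > 0" by simp
      show ?thesis
        by (rule frakM_gt_imp_disc[OF gt[OF pos] c(1) pos]) blast
    qed
    then obtain \<phi> w where \<phi>: "\<And>n. \<phi> n \<in> holomorphic_into unit_disc M"
      "\<And>n. norm (curve_deriv (\<phi> n) 0) > c" and w: "\<And>n. w n \<in> mfd_boundary M"
      and d: "\<And>n. dist (\<phi> n 0) (w n) < 2 * inverse (real (Suc n))"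
      by metis
    have "(\<lambda>n. dist (\<phi> n 0) (w n)) \<longlonglongrightarrow> 0"
    proof (rule tendsto_sandwich[OF _ _ tendsto_const])
      show "(\<lambda>n. 2 * inverse (real (Suc n))) \<longlonglongrightarrow> 0"
        using tendsto_mult_right_zero[OF LIMSEQ_inverse_real_of_nat] .
      show "\<forall>\<^sub>F n in sequentially. dist (\<phi> n 0) (w n) \<le> 2 * inverse (real (Suc n))"
        using less_imp_le[OF d] by (intro always_eventually) blast
    qed simp
    from taut_boundary_discs_compactly_divergent[of M \<phi> w, OF assms(3,6) \<phi>(1) w this]
    obtain r where "compactly_divergent M (\<lambda>n. \<phi> (r n))" .
    then show False
      by (rule visibility_imp_compactly_divergent_discs_flat[OF assms(1,3-5) \<phi>(1) _ c(1) \<phi>(2)])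
  qed
  then obtain r where r: "r > 0" "frakM M r \<le> ennreal c" by blast
  have "frakM M x < a" if "0 < x" "x < r" for x
    using frakM_mono[of x r M] that r(2) c(2) by (meson le_less_trans less_imp_le order_trans)
  then show "\<forall>\<^sub>F x in at_right 0. frakM M x < a"
    using r(1) by (auto simp: eventually_at_right_field)
qed simp

end
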